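(* For every $n\ge1$, the Lie group $G=\operatorname{SU}(2)\ltimes_{\tilde\rho}\mathbb H^n$ admits co-compact discrete subgroups.
   Context: $\mathbb H$ denotes the quaternions and $\mathbb H^n\cong\mathbb R^{4n}$ is regarded as an additive Lie group. $\operatorname{SU}(2)$ is identified with the group of unit quaternions, and $\tilde\rho:\operatorname{SU}(2)\to\operatorname{GL}(4n,\mathbb R)$ is the representation by left multiplication, $\tilde\rho(g)(q_1,\dots,q_n)=(gq_1,\dots,gq_n)$. The product in $G=\operatorname{SU}(2)\ltimes_{\tilde\rho}\mathbb H^n$ is $(g,(q_1,\dots,q_n))(g',(q_1',\dots,q_n'))=(gg',(q_1+gq_1',\dots,q_n+gq_n'))$. A discrete subgroup $\Gamma\subset G$ is co-compact if $\Gamma\backslash G$ is compact. *)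

theory Defs
  imports "HOL-Analysis.Analysis" "HOL-Algebra.Coset"
begin

section \<open>The real normed division algebra of quaternions\<close>

text \<open>\<open>Quat a b c d\<close> stands for \<open>a + b i + c j + d k\<close>, with \<open>i j = k\<close>.\<close>

codatatype quat = Quat (qre: real) (qi: real) (qj: real) (qk: real)

lemma quat_eq_iff:
  "x = y \<longleftrightarrow> qre x = qre y \<and> qi x = qi y \<and> qj x = qj y \<and> qk x = qk y"
  by (auto intro: quat.expand)

instantiation quat :: ring_1
begin

primcorec zero_quat where
  "qre 0 = 0" | "qi 0 = 0" | "qj 0 = 0" | "qk 0 = 0"

primcorec one_quat where
  "qre 1 = 1" | "qi 1 = 0" | "qj 1 = 0" | "qk 1 = 0"

primcorec plus_quat where
  "qre (x + y) = qre x + qre y"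
| "qi (x + y) = qi x + qi y"
| "qj (x + y) = qj x + qj y"
| "qk (x + y) = qk x + qk y"

primcorec uminus_quat where
  "qre (- x) = - qre x"
| "qi (- x) = - qi x"
| "qj (- x) = - qj x"
| "qk (- x) = - qk x"

primcorec minus_quat where
  "qre (x - y) = qre x - qre y"
| "qi (x - y) = qi x - qi y"
| "qj (x - y) = qj x - qj y"
| "qk (x - y) = qk x - qk y"

primcorec times_quat where
  "qre (x * y) = qre x * qre y - qi x * qi y - qj x * qj y - qk x * qk y"
| "qi (x * y) = qre x * qi y + qi x * qre y + qj x * qk y - qk x * qj y"
| "qj (x * y) = qre x * qj y - qi x * qk y + qj x * qre y + qk x * qi y"
| "qk (x * y) = qre x * qk y + qi x * qj y - qj x * qi y + qk x * qre y"

instance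
proof
  fix x y z :: quat
  show "x * y * z = x * (y * z)"
    unfolding quat_eq_iff times_quat.sel by (intro conjI; algebra)
  show "(x + y) * z = x * z + y * z"
    unfolding quat_eq_iff times_quat.sel plus_quat.sel by (intro conjI; algebra)
  show "x * (y + z) = x * y + x * z"
    unfolding quat_eq_iff times_quat.sel plus_quat.sel by (intro conjI; algebra)
qed (simp_all add: quat_eq_iff)

end

instantiation quat :: real_algebra_1
begin

primcorec scaleR_quat where
  "qre (scaleR r x) = r * qre x"
| "qi (scaleR r x) = r * qi x"
| "qj (scaleR r x) = r * qj x"
| "qk (scaleR r x) = r * qk x"

instance
  by standard (simp_all add: quat_eq_iff algebra_simps)

end

instantiation quat :: real_inner
begin

definition inner_quat :: "quat \<Rightarrow> quat \<Rightarrow> real" where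
  "inner_quat x y = qre x * qre y + qi x * qi y + qj x * qj y + qk x * qk y"

definition norm_quat :: "quat \<Rightarrow> real" where
  "norm_quat x = sqrt (inner x x)"

definition sgn_quat :: "quat \<Rightarrow> quat" where
  "sgn_quat x = x /\<^sub>R norm x"

definition dist_quat :: "quat \<Rightarrow> quat \<Rightarrow> real" where
  "dist_quat x y = norm (x - y)"

definition uniformity_quat :: "(quat \<times> quat) filter" where
  "uniformity_quat = (INF e\<in>{0 <..}. principal {(x, y). dist x y < e})"

definition open_quat :: "quat set \<Rightarrow> bool" where
  "open_quat U \<longleftrightarrow> (\<forall>x\<in>U. eventually (\<lambda>(x', y). x' = x \<longrightarrow> y \<in> U) uniformity)"

instance
proof
  fix x :: quat
  show "inner x x = 0 \<longleftrightarrow> x = 0"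
    by (simp add: inner_quat_def quat_eq_iff add_nonneg_eq_0_iff)
qed (simp_all add: quat_eq_iff inner_quat_def norm_quat_def sgn_quat_def dist_quat_def
       uniformity_quat_def open_quat_def algebra_simps)

end

lemma norm_quat_eq:
  "norm x = sqrt ((qre x)\<^sup>2 + (qi x)\<^sup>2 + (qj x)\<^sup>2 + (qk x)\<^sup>2)" for x :: quat
  by (simp add: norm_quat_def inner_quat_def power2_eq_square)

lemma four_squares:
  "(a * e - b * f - c * g - d * h)\<^sup>2 + (a * f + b * e + c * h - d * g)\<^sup>2 +
   (a * g - b * h + c * e + d * f)\<^sup>2 + (a * h + b * g - c * f + d * e)\<^sup>2 =
   (a\<^sup>2 + b\<^sup>2 + c\<^sup>2 + d\<^sup>2) * (e\<^sup>2 + f\<^sup>2 + g\<^sup>2 + h\<^sup>2)"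
  for a b c d e f g h :: real
  by algebra

instantiation quat :: real_normed_div_algebra
begin

primcorec inverse_quat where
  "qre (inverse x) = qre x / (norm x)\<^sup>2"
| "qi (inverse x) = - qi x / (norm x)\<^sup>2"
| "qj (inverse x) = - qj x / (norm x)\<^sup>2"
| "qk (inverse x) = - qk x / (norm x)\<^sup>2"

definition divide_quat :: "quat \<Rightarrow> quat \<Rightarrow> quat" where
  "divide_quat x y = x * inverse y"

instance
proof
  fix x y :: quat and r :: real
  show "inverse x * x = 1" if "x \<noteq> 0"
  proof -
    define s where "s = (norm x)\<^sup>2"
    have "s \<noteq> 0"
      using that by (simp add: s_def)
    moreover have "qre x * qre x + qi x * qi x + qj x * qj x + qk x * qk x = s"
      by (simp add: s_def norm_quat_eq power2_eq_square)
    ultimately show ?thesis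
      by (simp add: quat_eq_iff mult.commute flip: s_def add_divide_distrib diff_divide_distrib)
  qed
  show "x * inverse x = 1" if "x \<noteq> 0"
  proof -
    define s where "s = (norm x)\<^sup>2"
    have "s \<noteq> 0"
      using that by (simp add: s_def)
    moreover have "qre x * qre x + qi x * qi x + qj x * qj x + qk x * qk x = s"
      by (simp add: s_def norm_quat_eq power2_eq_square)
    ultimately show ?thesis
      by (simp add: quat_eq_iff mult.commute flip: s_def add_divide_distrib diff_divide_distrib)
  qed
  show "norm (x * y) = norm x * norm y"
    unfolding norm_quat_eq times_quat.sel four_squares real_sqrt_mult ..
  show "inverse (0::quat) = 0"
    by (simp add: quat_eq_iff)
qed (simp_all add: quat_eq_iff divide_quat_def algebra_simps)

end

section \<open>The semidirect product of \<open>SU(2)\<close> and \<open>\<H>\<^sup>n\<close>\<close>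

definition SU2 :: "quat set" where
  "SU2 = {g. norm g = 1}"

definition rho :: "quat \<Rightarrow> quat ^ 'n \<Rightarrow> quat ^ 'n" where
  "rho g q = g *s q"

definition SU2_ltimes :: "(quat \<times> (quat ^ 'n::finite)) monoid" where
  "SU2_ltimes = \<lparr>carrier = SU2 \<times> UNIV,
     mult = (\<lambda>(g, q) (g', q'). (g * g', q + rho g q')),
     one = (1, 0)\<rparr>"

lemma group_SU2_ltimes: "group SU2_ltimes"
proof (rule groupI)
  fix x :: "quat \<times> (quat ^ 'n)"
  assume "x \<in> carrier SU2_ltimes"
  then obtain g q where x: "x = (g, q)" and g: "norm g = 1" "g \<noteq> 0"
    by (force simp: SU2_ltimes_def SU2_def)
  let ?y = "(inverse g, - rho (inverse g) q)"
  have "?y \<in> carrier SU2_ltimes" "?y \<otimes>\<^bsub>SU2_ltimes\<^esub> x = \<one>\<^bsub>SU2_ltimes\<^esub>"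
    using g by (auto simp: x SU2_ltimes_def SU2_def rho_def norm_inverse)
  then show "\<exists>y\<in>carrier SU2_ltimes. y \<otimes>\<^bsub>SU2_ltimes\<^esub> x = \<one>\<^bsub>SU2_ltimes\<^esub>"
    by blast
next
  fix x y z :: "quat \<times> (quat ^ 'n)"
  show "x \<otimes>\<^bsub>SU2_ltimes\<^esub> y \<otimes>\<^bsub>SU2_ltimes\<^esub> z = x \<otimes>\<^bsub>SU2_ltimes\<^esub> (y \<otimes>\<^bsub>SU2_ltimes\<^esub> z)"
    by (cases x; cases y; cases z)
      (simp add: SU2_ltimes_def rho_def mult.assoc vector_add_ldistrib add.assoc)
qed (auto simp: SU2_ltimes_def SU2_def rho_def norm_mult)

section \<open>Co-compact subgroups\<close>

definition quotient_topology :: "'a topology \<Rightarrow> ('a \<Rightarrow> 'b) \<Rightarrow> 'b topology" where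
  "quotient_topology X f =
     topology (\<lambda>V. V \<subseteq> f ` topspace X \<and> openin X {x \<in> topspace X. f x \<in> V})"

lemma openin_quotient_topology:
  "openin (quotient_topology X f) V \<longleftrightarrow>
     V \<subseteq> f ` topspace X \<and> openin X {x \<in> topspace X. f x \<in> V}"
proof -
  have "istopology (\<lambda>V. V \<subseteq> f ` topspace X \<and> openin X {x \<in> topspace X. f x \<in> V})"
    unfolding istopology_def
  proof (intro conjI allI impI)
    fix S T
    assume *: "S \<subseteq> f ` topspace X \<and> openin X {x \<in> topspace X. f x \<in> S}"
      "T \<subseteq> f ` topspace X \<and> openin X {x \<in> topspace X. f x \<in> T}"
    have "{x \<in> topspace X. f x \<in> S \<inter> T} =
        {x \<in> topspace X. f x \<in> S} \<inter> {x \<in> topspace X. f x \<in> T}"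
      by auto
    then show "openin X {x \<in> topspace X. f x \<in> S \<inter> T}"
      using * by (simp only:) (intro openin_Int; simp)
    show "S \<inter> T \<subseteq> f ` topspace X"
      using * by blast
  next
    fix K
    assume *: "\<forall>S\<in>K. S \<subseteq> f ` topspace X \<and> openin X {x \<in> topspace X. f x \<in> S}"
    have "{x \<in> topspace X. f x \<in> \<Union>K} = (\<Union>S\<in>K. {x \<in> topspace X. f x \<in> S})"
      by auto
    then show "openin X {x \<in> topspace X. f x \<in> \<Union>K}"
      using * by (simp only:) (intro openin_Union; auto)
    show "\<Union>K \<subseteq> f ` topspace X"
      using * by blast
  qed
  then show ?thesis
    by (simp add: quotient_topology_def)
qed

lemma topspace_quotient_topology: "topspace (quotient_topology X f) = f ` topspace X"
proof
  show "topspace (quotient_topology X f) \<subseteq> f ` topspace X"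
    using openin_topspace[of "quotient_topology X f"] by (simp only: openin_quotient_topology)
  have "{x \<in> topspace X. f x \<in> f ` topspace X} = topspace X"
    by auto
  then show "f ` topspace X \<subseteq> topspace (quotient_topology X f)"
    by (simp add: openin_quotient_topology openin_subset)
qed

lemma quotient_map_quotient_topology: "quotient_map X (quotient_topology X f) f"
  unfolding quotient_map_def topspace_quotient_topology openin_quotient_topology by blast

text \<open>The orbit space \<open>\<Gamma>\G\<close> consists of the cosets \<open>\<Gamma> x\<close>, which are the right cosets
  \<open>\<Gamma> #> x\<close> of the library.\<close>

definition coset_space :: "('a, 'b) monoid_scheme \<Rightarrow> 'a topology \<Rightarrow> 'a set \<Rightarrow> 'a set topology" where
  "coset_space G T \<Gamma> = quotient_topology T (\<lambda>x. \<Gamma> #>\<^bsub>G\<^esub> x)"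

lemma topspace_coset_space:
  "topspace T = carrier G \<Longrightarrow> topspace (coset_space G T \<Gamma>) = rcosets\<^bsub>G\<^esub> \<Gamma>"
  by (auto simp: coset_space_def topspace_quotient_topology RCOSETS_def)

definition cocompact_discrete_subgroup ::
  "('a::topological_space, 'b) monoid_scheme \<Rightarrow> 'a set \<Rightarrow> bool" where
  "cocompact_discrete_subgroup G \<Gamma> \<longleftrightarrow>
     subgroup \<Gamma> G \<and> discrete \<Gamma> \<and>
     compact_space (coset_space G (top_of_set (carrier G)) \<Gamma>)"

end

theory Submission
  imports Defs
begin

text \<open>The group contains the lattice of integral points of \<open>\<H>\<^sup>n\<close>, embedded as \<open>{1} \<times> \<int>\<^sup>4\<^sup>n\<close>.
  It acts from the left on the second factor only, by translations, so that every coset has a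
  representative in the compact set of all \<open>(g, q)\<close> with \<open>q\<close> in a sufficiently large ball.\<close>

text \<open>Finite dimension brings in the Heine-Borel property: spheres in \<open>quat\<close> and
  closed balls in \<open>quat ^ 'n\<close> become compact.\<close>

instantiation quat :: euclidean_space
begin

definition Basis_quat :: "quat set" where
  "Basis_quat = {Quat 1 0 0 0, Quat 0 1 0 0, Quat 0 0 1 0, Quat 0 0 0 1}"

instance
proof
  fix u v x :: quat
  show "(Basis :: quat set) \<noteq> {}" "finite (Basis :: quat set)"
    by (simp_all add: Basis_quat_def)
  show "inner u v = (if u = v then 1 else 0)" if "u \<in> Basis" "v \<in> Basis"
    using that unfolding Basis_quat_def insert_iff empty_iff
    by (elim disjE; simp add: inner_quat_def)
  show "(\<forall>u\<in>Basis. inner x u = 0) \<longleftrightarrow> x = 0"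
    unfolding Basis_quat_def by (simp add: inner_quat_def quat_eq_iff[of x])
qed

end

lemma compact_SU2: "compact SU2"
proof -
  have "SU2 = sphere 0 1"
    by (auto simp: SU2_def)
  then show ?thesis
    by (metis compact_sphere)
qed

text \<open>These are the Lipschitz quaternions, used as an additive lattice of rank 4.\<close>

definition integral_quat :: "quat set" where
  "integral_quat = {x. qre x \<in> \<int> \<and> qi x \<in> \<int> \<and> qj x \<in> \<int> \<and> qk x \<in> \<int>}"

definition integral_points :: "(quat ^ 'n) set" where
  "integral_points = {q. \<forall>i. q $ i \<in> integral_quat}"

lemma integral_points_zero: "0 \<in> integral_points"
  and integral_points_add: "p \<in> integral_points \<Longrightarrow> q \<in> integral_points \<Longrightarrow> p + q \<in> integral_points"
  and integral_points_minus: "p \<in> integral_points \<Longrightarrow> - p \<in> integral_points"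
  by (auto simp: integral_points_def integral_quat_def)

text \<open>Some coordinate is a nonzero integer; its square is at least 1, and the other three
  squares are nonnegative.\<close>

lemma norm_integral_quat_ge_1:
  assumes "x \<in> integral_quat" "x \<noteq> 0"
  shows "norm x \<ge> 1"
proof -
  have *: "1 \<le> r\<^sup>2" if "r \<in> \<int>" "r \<noteq> 0" for r :: real
    using one_le_power[OF Ints_nonzero_abs_ge1[OF that], of 2] by simp
  have "1 \<le> (qre x)\<^sup>2 + (qi x)\<^sup>2 + (qj x)\<^sup>2 + (qk x)\<^sup>2"
    using assms *[of "qre x"] *[of "qi x"] *[of "qj x"] *[of "qk x"]
      zero_le_power2[of "qre x"] zero_le_power2[of "qi x"] zero_le_power2[of "qj x"]
      zero_le_power2[of "qk x"]
    unfolding integral_quat_def quat_eq_iff zero_quat.sel mem_Collect_eq by (smt (verit))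
  then show ?thesis
    by (simp add: norm_quat_eq)
qed

text \<open>The difference is again integral and has a nonzero entry, whose norm bounds the norm of
  the whole vector from below. The bound is uniform, so one radius isolates every lattice
  point.\<close>

lemma dist_integral_points_ge_1:
  assumes "p \<in> integral_points" "q \<in> integral_points" "p \<noteq> q"
  shows "dist p q \<ge> 1"
proof -
  obtain i where i: "(p - q) $ i \<noteq> 0"
    using assms(3) by (auto simp: vec_eq_iff)
  have "(p - q) $ i \<in> integral_quat"
    using assms(1,2) by (auto simp: integral_points_def integral_quat_def)
  then have "1 \<le> norm ((p - q) $ i)"
    using i by (rule norm_integral_quat_ge_1)
  also have "\<dots> \<le> norm (p - q)"
    by (rule Finite_Cartesian_Product.norm_nth_le)
  finally show ?thesis
    by (simp add: dist_norm)
qed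

lemma quat_near_integral:
  obtains z where "z \<in> integral_quat" "norm (x - z) \<le> 2"
proof
  \<comment> \<open>Rounding down leaves four errors in [0,1), so the squared norm of the difference
    is at most 4.\<close>
  let ?z = "Quat \<lfloor>qre x\<rfloor> \<lfloor>qi x\<rfloor> \<lfloor>qj x\<rfloor> \<lfloor>qk x\<rfloor>"
  show "?z \<in> integral_quat"
    by (simp add: integral_quat_def)
  have *: "(r - of_int \<lfloor>r\<rfloor>)\<^sup>2 \<le> 1" for r :: real
    by (intro power_le_one) linarith+
  have "(norm (x - ?z))\<^sup>2 \<le> 2\<^sup>2"
    using *[of "qre x"] *[of "qi x"] *[of "qj x"] *[of "qk x"] by (simp add: norm_quat_eq)
  then show "norm (x - ?z) \<le> 2"
    by (rule power2_le_imp_le) simp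
qed

lemma vec_near_integral:
  fixes q :: "quat ^ 'n::finite"
  obtains z where "z \<in> integral_points" "norm (q - z) \<le> 2 * CARD('n)"
proof -
  have "\<forall>i. \<exists>z. z \<in> integral_quat \<and> norm (q $ i - z) \<le> 2"
    using quat_near_integral by metis
  then obtain z where z: "\<And>i. z i \<in> integral_quat" "\<And>i. norm (q $ i - z i) \<le> 2"
    by metis
  \<comment> \<open>The Euclidean norm is estimated crudely by the sum of the norms of the entries:
    any bound independent of \<open>q\<close> serves for compactness.\<close>
  have "norm (q - vec_lambda z) \<le> (\<Sum>i\<in>UNIV. norm (q $ i - z i))"
    unfolding norm_vec_def using L2_set_le_sum[of UNIV "\<lambda>i. norm (q $ i - z i)"] by simp
  also have "\<dots> \<le> (\<Sum>i\<in>(UNIV :: 'n set). 2)"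
    by (intro sum_mono z)
  finally have "norm (q - vec_lambda z) \<le> 2 * CARD('n)"
    by (simp add: mult.commute)
  moreover have "vec_lambda z \<in> integral_points"
    using z by (simp add: integral_points_def)
  ultimately show ?thesis
    using that by blast
qed

text \<open>Since \<open>rho 1\<close> is the identity, the group law on pairs with first component
  1 is vector addition.\<close>

lemma subgroup_integral_points: "subgroup ({1} \<times> integral_points) SU2_ltimes"
proof -
  interpret group SU2_ltimes
    by (rule group_SU2_ltimes)
  show ?thesis
  proof (rule subgroupI)
    show "{1} \<times> integral_points \<subseteq> carrier SU2_ltimes"
      by (auto simp: SU2_ltimes_def SU2_def)
    show "{1} \<times> integral_points \<noteq> {}"
      using integral_points_zero by blast
  next
    fix x :: "quat \<times> (quat ^ 'n)"
    assume "x \<in> {1} \<times> integral_points"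
    then obtain q where x: "x = (1, q)" "q \<in> integral_points"
      by auto
    have "inv\<^bsub>SU2_ltimes\<^esub> x = (1, - q)"
      by (rule inv_equality) (auto simp: x SU2_ltimes_def SU2_def rho_def)
    then show "inv\<^bsub>SU2_ltimes\<^esub> x \<in> {1} \<times> integral_points"
      using x by (simp add: integral_points_minus)
  next
    fix x y :: "quat \<times> (quat ^ 'n)"
    assume "x \<in> {1} \<times> integral_points" "y \<in> {1} \<times> integral_points"
    then show "x \<otimes>\<^bsub>SU2_ltimes\<^esub> y \<in> {1} \<times> integral_points"
      by (auto simp: SU2_ltimes_def rho_def integral_points_add)
  qed
qed

lemma discrete_integral_points: "discrete ({1 :: quat} \<times> integral_points)"
  unfolding discrete_def
proof
  fix x :: "quat \<times> (quat ^ 'n)"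
  assume x: "x \<in> {1} \<times> integral_points"
  have "y = x" if "y \<in> ball x 1" "y \<in> {1} \<times> integral_points" for y
  proof -
    obtain p q where *: "x = (1, p)" "p \<in> integral_points" "y = (1, q)" "q \<in> integral_points"
      using x \<open>y \<in> {1} \<times> integral_points\<close> by auto
    \<comment> \<open>The first components agree, so the distance in the product is that of the
      second components.\<close>
    moreover have "dist p q < 1"
      using that(1) by (simp add: * dist_Pair_Pair)
    ultimately show ?thesis
      using dist_integral_points_ge_1[of p q] by auto
  qed
  then have "ball x 1 \<inter> ({1} \<times> integral_points) = {x}"
    using x by (intro equalityI subsetI) auto
  then show "x isolated_in {1} \<times> integral_points"
    using x unfolding isolated_in_def by (metis open_ball)
qed

text \<open>The quotient map is continuous and \<open>K\<close> meets every coset, so the coset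
  space is the continuous image of a compact set.\<close>

lemma compact_space_coset_space:
  assumes "compact K" "K \<subseteq> carrier G"
    and "\<And>x. x \<in> carrier G \<Longrightarrow> \<exists>y\<in>K. \<Gamma> #>\<^bsub>G\<^esub> x = \<Gamma> #>\<^bsub>G\<^esub> y"
  shows "compact_space (coset_space G (top_of_set (carrier G)) \<Gamma>)"
proof -
  let ?X = "coset_space G (top_of_set (carrier G)) \<Gamma>" and ?f = "\<lambda>x. \<Gamma> #>\<^bsub>G\<^esub> x"
  have "continuous_map (top_of_set (carrier G)) ?X ?f"
    unfolding coset_space_def
    by (intro quotient_imp_continuous_map quotient_map_quotient_topology)
  then have "compactin ?X (?f ` K)"
    using assms(1,2) by (intro image_compactin[of "top_of_set (carrier G)"])
      (auto simp: compactin_subtopology)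
  moreover have "?f ` K = topspace ?X"
    using assms(2,3) unfolding coset_space_def topspace_quotient_topology by (simp, blast)
  ultimately show ?thesis
    by (simp add: compact_space_def)
qed

theorem mainTheorem20:
  shows "\<exists>\<Gamma>. cocompact_discrete_subgroup (SU2_ltimes :: (quat \<times> (quat ^ 'n::finite)) monoid) \<Gamma>"
proof
  let ?G = "SU2_ltimes :: (quat \<times> (quat ^ 'n)) monoid"
  let ?\<Gamma> = "{1} \<times> integral_points :: (quat \<times> (quat ^ 'n)) set"
  let ?K = "SU2 \<times> cball 0 (2 * CARD('n)) :: (quat \<times> (quat ^ 'n)) set"
  interpret group ?G
    by (rule group_SU2_ltimes)
  have "compact_space (coset_space ?G (top_of_set (carrier ?G)) ?\<Gamma>)"
  proof (rule compact_space_coset_space)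
    show "compact ?K"
      by (intro compact_Times compact_SU2 compact_cball)
    show "?K \<subseteq> carrier ?G"
      by (auto simp: SU2_ltimes_def)
  next
    fix x assume x: "x \<in> carrier ?G"
    then obtain g q where gq: "x = (g, q)" "g \<in> SU2"
      by (auto simp: SU2_ltimes_def)
    obtain z where z: "z \<in> integral_points" "norm (q - z) \<le> 2 * CARD('n)"
      by (rule vec_near_integral)
    \<comment> \<open>Left multiplication by \<open>(1, - z)\<close> fixes \<open>g\<close> and
      translates \<open>q\<close> by \<open>- z\<close> whatever \<open>g\<close> is. On the right
      it would translate by \<open>- rho g z\<close>.\<close>
    have "(g, q - z) = (1, - z) \<otimes>\<^bsub>?G\<^esub> x"
      by (simp add: gq SU2_ltimes_def rho_def)
    then have "(g, q - z) \<in> ?\<Gamma> #>\<^bsub>?G\<^esub> x"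
      using z integral_points_minus unfolding r_coset_def by blast
    then have "?\<Gamma> #>\<^bsub>?G\<^esub> x = ?\<Gamma> #>\<^bsub>?G\<^esub> (g, q - z)"
      using x subgroup_integral_points by (rule repr_independence)
    moreover have "(g, q - z) \<in> ?K"
      using gq z by simp
    ultimately show "\<exists>y\<in>?K. ?\<Gamma> #>\<^bsub>?G\<^esub> x = ?\<Gamma> #>\<^bsub>?G\<^esub> y"
      by blast
  qed
  then show "cocompact_discrete_subgroup ?G ?\<Gamma>"
    by (simp add: cocompact_discrete_subgroup_def subgroup_integral_points discrete_integral_points)
qed

end
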